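(* Let $(a,b)\in\mathcal P\setminus\mathcal E$. If the $(a,b)$-expansion admits a dual expansion $(a',b')$, and $\gamma_0$ is an $(a,b)$-reduced geodesic from $u_0$ to $w_0$ (with irrational end points and a well-defined coding sequence), then its coding sequence $$\lfloor\gamma_0\rceil=\lfloor\dots,n_{-2},n_{-1},n_0,n_1,n_2,\dots\rceil$$ is obtained by juxtaposing the $(a,b)$-expansion of $w_0=\lfloor n_0,n_1,n_2,\dots\rceil_{a,b}$ and the $(a',b')$-expansion of $1/u_0=\lfloor n_{-1},n_{-2},\dots\rceil_{a',b'}$. This property is preserved under the left shift of the sequence: for $(u_1,w_1)=(ST^{-n_0}u_0,ST^{-n_0}w_0)$ one has $w_1=\lfloor n_1,n_2,\dots\rceil_{a,b}$ and $1/u_1=\lfloor n_0,n_{-1},n_{-2},\dots\rceil_{a',b'}$.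
   Context: Notation: $\bar{\mathbb R}=\mathbb R\cup\{\infty\}$, $T(x)=x+1$, $S(x)=-1/x$, $\mathcal P=\{(a,b): a\le 0\le b,\ b-a\ge 1,\ -ab\le 1\}$. Let $\Delta=\{(x,y)\in\bar{\mathbb R}^2: x=y\}$ and let $F_{a,b}:\bar{\mathbb R}^2\setminus\Delta\to\bar{\mathbb R}^2\setminus\Delta$ be $F_{a,b}(x,y)=(x+1,y+1)$ if $y<a$; $(-1/x,-1/y)$ if $a\le y<b$; $(x-1,y-1)$ if $y\ge b$. Standing assumption: $(a,b)\in\mathcal P\setminus\mathcal E$, where $\mathcal E\subset\{b=a+1\}$ is the explicit exceptional set (uncountable, of one-dimensional Lebesgue measure zero) of a known theorem of Katok and Ugarcovici asserting that for $(a,b)\in\mathcal P\setminus\mathcal E$: (1) $D_{a,b}=\bigcap_{n\ge0}F_{a,b}^n(\bar{\mathbb R}^2\setminus\Delta)$ is an attractor on which $F_{a,b}$ is essentially bijective (bijective except for some boundary segments and their images); (2) $D_{a,b}$ has two (or one, in degenerate cases) connected components, each bounded by non-decreasing step functions with finitely many steps; (3) almost every $(x,y)$, $x\neq y$, is mapped into $D_{a,b}$ after finitely many iterations of $F_{a,b}$. These properties of $(a,b)$ may be assumed. $(a,b)$-expansions: put $\lfloor x\rceil_{a,b}=\lfloor x-a\rfloor$ if $x<a$, $0$ if $a\le x<b$, and $\lceil x-b\rceil$ if $x\ge b$, where $\lceil t\rceil:=\lfloor t\rfloor+1$. For $(a,b)\in\mathcal P$ every irrational $x$ is uniquely $x=n_0-\cfrac{1}{n_1-\cfrac{1}{n_2-\cdots}}=:\lfloor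 n_0,n_1,\dots\rceil_{a,b}$ with $n_0=\lfloor x\rceil_{a,b}$, $x_1=-1/(x-n_0)$, $n_k=\lfloor x_k\rceil_{a,b}$, $x_{k+1}=-1/(x_k-n_k)$ (known). Reduced geodesics: a geodesic on the hyperbolic upper half-plane $\mathcal H$ from $u$ (repelling end point) to $w$ (attracting end point) is identified with $(u,w)$. It is $(a,b)$-reduced if $(u,w)\in\Lambda_{a,b}:=S(D_{a,b}\cap\{a\le w\le b\})$, with $S$ acting on both coordinates. The reduction map is $R_{a,b}(u,w)=(ST^{-n}u,ST^{-n}w)$, where $n$ is the first digit of the $(a,b)$-expansion of $w$; it maps $\Lambda_{a,b}$ to itself bijectively except for some boundary segments and their images. Coding sequence: for an $(a,b)$-reduced geodesic $(u_0,w_0)$ with well-defined two-sided orbit $(u_k,w_k)=R_{a,b}^k(u_0,w_0)\in\Lambda_{a,b}$, $k\in\mathbb Z$, the coding sequence is $\{n_k\}_{k\in\mathbb Z}$, where $n_k$ is the first digit of $w_k$. Thus $(u_{k+1},w_{k+1})=(ST^{-n_k}u_k,ST^{-n_k}w_k)$ for all $k\in\mathbb Z$. Dual expansion: let $\psi(x,y)=(-y,-x)$. If $\psi(D_{a,b})$ coincides with the attractor $D_{a',b'}$ of $F_{a',b'}$ for some $(a',b')\in\mathcal P$, then the $(a',b')$-expansion is called the dual expansion to $(a,b)$.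
   Formalization: The attractor is taken as any closed region with properties (1)-(3), since the intersection formula read literally gives the whole space; "well-defined coding sequence" requires the backward orbit, including the geodesic itself, to lie in the interior of Λ, as the claim can fail on its boundary. *)

theory Defs
  imports "HOL-Analysis.Analysis"
begin

text \<open>The projective line: \<open>None\<close> is the point at infinity.\<close>

type_synonym xreal = "real option"

definition T_pow :: "int \<Rightarrow> xreal \<Rightarrow> xreal" where
  "T_pow n = map_option (\<lambda>x. x + of_int n)"

fun S_map :: "xreal \<Rightarrow> xreal" where
  "S_map None = Some 0"
| "S_map (Some x) = (if x = 0 then None else Some (- 1 / x))"

definition diag :: "(xreal \<times> xreal) set" where
  "diag = {p. fst p = snd p}"

definition ab_params :: "(real \<times> real) set" where
  "ab_params = {(a, b). a \<le> 0 \<and> 0 \<le> b \<and> b - a \<ge> 1 \<and> - a * b \<le> 1}"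

text \<open>For \<open>y = \<infinity>\<close> the last branch is used. Nothing below depends on this choice, because
  exceptional horizontal lines, including \<open>y = \<infinity>\<close>, are disregarded.\<close>

definition F_map :: "real \<Rightarrow> real \<Rightarrow> xreal \<times> xreal \<Rightarrow> xreal \<times> xreal" where
  "F_map a b p =
     (case snd p of
        Some y \<Rightarrow>
          if y < a then map_prod (T_pow 1) (T_pow 1) p
          else if y < b then map_prod S_map S_map p
          else map_prod (T_pow (- 1)) (T_pow (- 1)) p
      | None \<Rightarrow> map_prod (T_pow (- 1)) (T_pow (- 1)) p)"

text \<open>Closed arcs of the projective line with one end point at infinity.\<close>

definition arc_le :: "real \<Rightarrow> xreal set" where
  "arc_le c = insert None (Some ` {..c})"

definition arc_ge :: "real \<Rightarrow> xreal set" where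
  "arc_ge c = insert None (Some ` {c..})"

text \<open>The (closed) region on and above, respectively on and below, a non-decreasing step function
  with finitely many steps is a finite union of quadrants, one for each corner \<open>(p, q)\<close> of its
  graph. The conditions \<open>p \<le> q\<close> and \<open>q \<le> p\<close> say that the upper region lies above the diagonal and
  the lower one below it, so that in the affine plane the two regions are separated by the
  diagonal; in the degenerate cases one of them is empty.\<close>

definition finite_rectangular :: "(xreal \<times> xreal) set \<Rightarrow> bool" where
  "finite_rectangular D \<longleftrightarrow>
     (\<exists>U L :: (real \<times> real) set. finite U \<and> finite L \<and> U \<union> L \<noteq> {} \<and>
        (\<forall>(p, q) \<in> U. p \<le> q) \<and> (\<forall>(p, q) \<in> L. q \<le> p) \<and>
        D = ((\<Union>(p, q) \<in> U. arc_le p \<times> arc_ge q) \<union> (\<Union>(p, q) \<in> L. arc_ge p \<times> arc_le q)) - diag)"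

text \<open>Bijective apart from subsets \<open>N\<close> of the domain and \<open>N'\<close> of the range which are contained in
  finitely many horizontal and vertical lines (the boundary segments and their images).\<close>

definition essentially_bijective ::
    "(xreal \<times> xreal \<Rightarrow> xreal \<times> xreal) \<Rightarrow> (xreal \<times> xreal) set \<Rightarrow> bool" where
  "essentially_bijective f D \<longleftrightarrow>
     (\<exists>(A :: xreal set) N N'. finite A \<and>
        N \<subseteq> {(x, y). x \<in> A \<or> y \<in> A} \<and> N' \<subseteq> {(x, y). x \<in> A \<or> y \<in> A} \<and>
        bij_betw f (D - N) (D - N'))"

text \<open>\<open>D\<close> is the attractor of \<open>F_map a b\<close>: a closed region with the three properties of the
  theorem of Katok and Ugarcovici. That \<open>(a, b)\<close> is not exceptional means that such a \<open>D\<close> exists.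

  The formula "intersection of the \<open>F^n(X)\<close>, \<open>n \<ge> 0\<close>", where \<open>X\<close> is the complement of the diagonal,
  cannot be used literally. If \<open>y < a + 1\<close>, then \<open>(x, y) = F^n(x - n, y - n)\<close> for all \<open>n\<close>, and if
  \<open>y \<ge> b - 1\<close>, then \<open>(x, y) = F^n(x + n, y + n)\<close> for all \<open>n\<close>; hence for \<open>b - a \<le> 2\<close> the intersection
  over all of \<open>X\<close> is \<open>X\<close> itself, on which \<open>F\<close> is far from injective. The formula is meaningful
  with an absorbing region in place of \<open>X\<close>, and then expresses the essential invariance of \<open>D\<close>,
  which is part of \<open>essentially_bijective\<close>, together with absorption of almost every point.
  The region is taken closed, so that equality of attractors is not affected by
  which boundary segments the half-open branches of \<open>F\<close> happen to attain.\<close>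

definition ab_attractor :: "real \<Rightarrow> real \<Rightarrow> (xreal \<times> xreal) set \<Rightarrow> bool" where
  "ab_attractor a b D \<longleftrightarrow>
     essentially_bijective (F_map a b) D \<and>
     finite_rectangular D \<and>
     (AE p in (lborel :: (real \<times> real) measure). fst p \<noteq> snd p \<longrightarrow>
        (\<exists>n. (F_map a b ^^ n) (Some (fst p), Some (snd p)) \<in> D))"

text \<open>The duality \<open>(x, y) \<mapsto> (-y, -x)\<close>.\<close>

definition psi :: "xreal \<times> xreal \<Rightarrow> xreal \<times> xreal" where
  "psi p = (map_option uminus (snd p), map_option uminus (fst p))"

definition dual_expansion :: "(xreal \<times> xreal) set \<Rightarrow> real \<Rightarrow> real \<Rightarrow> bool" where
  "dual_expansion D a' b' \<longleftrightarrow> (a', b') \<in> ab_params \<and> ab_attractor a' b' (psi ` D)"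

definition ab_int :: "real \<Rightarrow> real \<Rightarrow> real \<Rightarrow> int" where
  "ab_int a b x = (if x < a then \<lfloor>x - a\<rfloor> else if x < b then 0 else \<lfloor>x - b\<rfloor> + 1)"

primrec ab_tail :: "real \<Rightarrow> real \<Rightarrow> real \<Rightarrow> nat \<Rightarrow> real" where
  "ab_tail a b x 0 = x"
| "ab_tail a b x (Suc k) = - 1 / (ab_tail a b x k - of_int (ab_int a b (ab_tail a b x k)))"

text \<open>The \<open>(a, b)\<close>-expansion of an irrational \<open>x\<close>, as the sequence of its digits.\<close>

definition ab_expansion :: "real \<Rightarrow> real \<Rightarrow> real \<Rightarrow> nat \<Rightarrow> int" where
  "ab_expansion a b x k = ab_int a b (ab_tail a b x k)"

definition Lam :: "real \<Rightarrow> real \<Rightarrow> (xreal \<times> xreal) set \<Rightarrow> (xreal \<times> xreal) set" where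
  "Lam a b D = map_prod S_map S_map ` (D \<inter> {(x, y). y \<in> Some ` {a..b}})"

text \<open>The reduction map on geodesics with real end points \<open>u\<close> (repelling) and \<open>w\<close> (attracting).\<close>

definition R_map :: "real \<Rightarrow> real \<Rightarrow> real \<times> real \<Rightarrow> xreal \<times> xreal" where
  "R_map a b p =
     (let n = ab_int a b (snd p)
      in (S_map (T_pow (- n) (Some (fst p))), S_map (T_pow (- n) (Some (snd p)))))"

text \<open>A reduced geodesic \<open>(u 0, w 0)\<close> with irrational end points and a well-defined two-sided orbit.
  The reduction map is bijective on \<open>Lam a b D\<close> only up to boundary segments and their images. So
  \<open>(u 0, w 0)\<close> must avoid the boundary of \<open>Lam a b D\<close> and its forward images, that is, the backward
  orbit runs through the interior. The forward orbit is unrestricted.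

  Boundary points are a genuine exception, even if the backward orbit is unique there. With
  \<open>g = (sqrt 5 - 1) / 2\<close>, \<open>(a, b) = (-1/2, 1/2)\<close> and the dual \<open>(-g, g)\<close>, take \<open>u 0 = g - 1\<close> and
  \<open>-5/2 < w 0 < -2\<close>: then \<open>u k = g - 1\<close> for all \<open>k \<le> 0\<close> and the digits read backwards from \<open>n 0\<close>
  are \<open>-2, -3, -3, ...\<close>, whereas the \<open>(-g, g)\<close>-expansion of \<open>1 / u 1 = - g - 1\<close> is
  \<open>-1, 2, 3, 3, ...\<close>.\<close>

definition coded_orbit ::
    "real \<Rightarrow> real \<Rightarrow> (xreal \<times> xreal) set \<Rightarrow> (int \<Rightarrow> real) \<Rightarrow> (int \<Rightarrow> real) \<Rightarrow> bool" where
  "coded_orbit a b D u w \<longleftrightarrow>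
     u 0 \<notin> \<rat> \<and> w 0 \<notin> \<rat> \<and>
     (\<forall>k. (Some (u k), Some (w k)) \<in> Lam a b D) \<and>
     (\<forall>k. (Some (u (k + 1)), Some (w (k + 1))) = R_map a b (u k, w k)) \<and>
     (\<forall>k\<le>0. (u k, w k) \<in> interior {(x, y). (Some x, Some y) \<in> Lam a b D})"

definition coding_sequence :: "real \<Rightarrow> real \<Rightarrow> (int \<Rightarrow> real) \<Rightarrow> int \<Rightarrow> int" where
  "coding_sequence a b w k = ab_int a b (w k)"

end

theory Submission
  imports Defs
begin

text \<open>Essential bijectivity forces the part of \<open>D\<close> below the diagonal to lie in
  \<open>y \<le> a + 1\<close>, and the part above it in \<open>y \<ge> b - 1\<close>: otherwise the preimages of points of \<open>D\<close> with
  \<open>x\<close> close to infinity would have to come from the branch \<open>S\<close>, and following them to \<open>x\<close> just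
  below \<open>0\<close> makes two branches overlap. Applied to \<open>psi D\<close> and \<open>(a', b')\<close> this bounds the first
  coordinate on \<open>D\<close> as well. If now \<open>(u, w)\<close> is reduced with \<open>w > b\<close>, then \<open>(u, w)\<close> lies in the
  upper part of \<open>D\<close>, so \<open>u < 1 - b'\<close>; and \<open>u < - b'\<close> is impossible, since then the dual map would put
  \<open>(u + 1, w + 1)\<close> into \<open>D\<close>, a second preimage of \<open>(u, w)\<close> besides \<open>S (u, w)\<close>. Hence
  \<open>n - u\<close> has the first dual digit \<open>n\<close>, where \<open>n\<close> is the first digit of \<open>w\<close>.\<close>

section \<open>Staircase regions, tilings and the height bounds\<close>

lemma generic_between:
  fixes c d :: real
  assumes "finite B" "c < d"
  obtains x where "c < x" "x < d" "x \<notin> B"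
proof -
  have "infinite ({c<..<d} - B)"
    using assms by (simp add: infinite_Ioo)
  then obtain x where "x \<in> {c<..<d} - B"
    by (metis equals0I finite.emptyI)
  then show thesis using that by auto
qed

text \<open>These are the features of a step-function region below the diagonal on which the height
  bound rests: it grows to the right and downwards, and its extreme height \<open>r\<close> and
  extreme left abscissa \<open>s\<close> are attained. The second clause is conditional because this
  part is empty in degenerate cases.\<close>

definition lower_staircase :: "(real \<times> real) set \<Rightarrow> bool" where
  "lower_staircase E \<longleftrightarrow>
     (\<forall>x y x' y'. (x, y) \<in> E \<longrightarrow> y < x \<longrightarrow> x \<le> x' \<longrightarrow> y' \<le> y \<longrightarrow> (x', y') \<in> E) \<and>
     ((\<exists>x y. (x, y) \<in> E \<and> y < x) \<longrightarrow>
      (\<exists>r s X Y. (\<forall>x y. (x, y) \<in> E \<longrightarrow> y < x \<longrightarrow> s \<le> x \<and> y \<le> r) \<and>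
         r < X \<and> (X, r) \<in> E \<and> Y < s \<and> (s, Y) \<in> E))"

text \<open>Reflection in the origin exchanges the two sides of the diagonal, so each fact about the
  lower part yields its counterpart for the upper part.\<close>

definition reflect :: "(real \<times> real) set \<Rightarrow> (real \<times> real) set" where
  "reflect E = {(x, y). (- x, - y) \<in> E}"

lemma mem_reflect [simp]: "(x, y) \<in> reflect E \<longleftrightarrow> (- x, - y) \<in> E"
  by (simp add: reflect_def)

lemma reflect_reflect [simp]: "reflect (reflect E) = E"
  by (auto simp: reflect_def)

text \<open>\<open>B\<close> collects the exceptional coordinates. Off \<open>B\<close> strict and weak inequalities are
  interchangeable, and writing all branch conditions with weak ones makes the notion invariant
  under \<open>(x, y) \<mapsto> (- x, - y)\<close>, \<open>(a, b) \<mapsto> (- b, - a)\<close>.\<close>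

locale tiling =
  fixes a b :: real and E :: "(real \<times> real) set" and B :: "real set"
  assumes params: "a \<le> 0" "0 \<le> b" "1 \<le> b - a" "- (a * b) \<le> 1"
    and finite_B: "finite B" and in_B: "0 \<in> B" "a \<in> B" "b \<in> B"
    and lower: "lower_staircase E" and upper: "lower_staircase (reflect E)"
    and cover: "\<And>x y. \<lbrakk>(x, y) \<in> E; x \<notin> B; y \<notin> B\<rbrakk> \<Longrightarrow>
      y - 1 \<le> a \<and> (x - 1, y - 1) \<in> E \<or>
      a \<le> - 1 / y \<and> - 1 / y \<le> b \<and> (- 1 / x, - 1 / y) \<in> E \<or>
      b \<le> y + 1 \<and> (x + 1, y + 1) \<in> E"
    and disjoint_up: "\<And>x y. \<lbrakk>x \<notin> B; y \<notin> B; (x - 1, y - 1) \<in> E; y - 1 \<le> a;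
      (- 1 / x, - 1 / y) \<in> E; a \<le> - 1 / y; - 1 / y \<le> b\<rbrakk> \<Longrightarrow> False"
    and disjoint_down: "\<And>x y. \<lbrakk>x \<notin> B; y \<notin> B; (x + 1, y + 1) \<in> E; b \<le> y + 1;
      (- 1 / x, - 1 / y) \<in> E; a \<le> - 1 / y; - 1 / y \<le> b\<rbrakk> \<Longrightarrow> False"
    and step_up: "\<And>x y. \<lbrakk>(x, y) \<in> E; x \<notin> B; y \<notin> B; y \<le> a\<rbrakk> \<Longrightarrow> (x + 1, y + 1) \<in> E"
    and step_down: "\<And>x y. \<lbrakk>(x, y) \<in> E; x \<notin> B; y \<notin> B; b \<le> y\<rbrakk> \<Longrightarrow> (x - 1, y - 1) \<in> E"
    and step_inv: "\<And>x y. \<lbrakk>(x, y) \<in> E; x \<notin> B; y \<notin> B; a \<le> y; y \<le> b\<rbrakk> \<Longrightarrow> (- 1 / x, - 1 / y) \<in> E"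
begin

lemma lower_mono:
  assumes "(x, y) \<in> E" "y < x" "x \<le> x'" "y' \<le> y"
  shows "(x', y') \<in> E"
  using lower assms unfolding lower_staircase_def by blast

lemma lower_height:
  assumes "(x0, y0) \<in> E" "y0 < x0"
  shows "y0 \<le> a + 1"
proof (rule ccontr)
  assume neg: "\<not> y0 \<le> a + 1"
  have "\<exists>x y. (x, y) \<in> E \<and> y < x" using assms by blast
  then have "\<exists>r s X Y. (\<forall>x y. (x, y) \<in> E \<longrightarrow> y < x \<longrightarrow> s \<le> x \<and> y \<le> r) \<and>
      r < X \<and> (X, r) \<in> E \<and> Y < s \<and> (s, Y) \<in> E"
    using lower unfolding lower_staircase_def by (elim conjE) (erule (1) mp)
  then obtain r s X Y where ext: "\<And>x y. (x, y) \<in> E \<Longrightarrow> y < x \<Longrightarrow> s \<le> x \<and> y \<le> r"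
    and X: "r < X" "(X, r) \<in> E" and Y: "Y < s" "(s, Y) \<in> E"
    by blast
  have r: "a + 1 < r" using ext[OF assms] neg by simp
  \<comment> \<open>If \<open>b = 0\<close>, points near \<open>y = - \<infinity>\<close> can only be reached by translation from the left.\<close>
  have "b \<noteq> 0"
  proof
    assume b0: "b = 0"
    obtain x where x: "s < x" "x < s + 1" "x \<notin> B"
      using generic_between[OF finite_B, of s "s + 1"] by auto
    obtain y where y: "min Y (-1) - 1 < y" "y < min Y (-1)" "y \<notin> B"
      using generic_between[OF finite_B, of "min Y (-1) - 1" "min Y (-1)"]
      by (metis diff_gt_0_iff_gt diff_less_eq less_add_one)
    have "(x, y) \<in> E" using lower_mono[OF Y(2,1), of x y] x y by simp
    from cover[OF this x(3) y(3)] show False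
    proof (elim disjE conjE)
      assume "(x - 1, y - 1) \<in> E"
      from ext[OF this] show False using x y Y by auto
    next
      assume "- 1 / y \<le> b"
      then show False using b0 y by (simp add: field_simps)
    qed (use b0 y in auto)
  qed
  then have b: "0 < b" using params by simp
  \<comment> \<open>Heights above \<open>a + 1\<close> are out of reach of \<open>T\<close>; heights
    above \<open>r - 1\<close> could arise under the inverse translation only from points above the
    maximal height \<open>r\<close>.\<close>
  obtain y1 where y1: "max (a + 1) (r - 1) < y1" "y1 < r" "y1 \<notin> B"
    using generic_between[OF finite_B, of "max (a + 1) (r - 1)" r] r by auto
  \<comment> \<open>Neither translation reaches a point at the height \<open>y1\<close> near \<open>x = + \<infinity>\<close>.\<close>
  have pre: "a \<le> - 1 / y1 \<and> - 1 / y1 \<le> b \<and> (- 1 / x, - 1 / y1) \<in> E"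
    if "X \<le> x" "x \<notin> B" for x
  proof -
    have "(x, y1) \<in> E" using lower_mono[OF X(2,1), of x y1] that y1 by simp
    from cover[OF this that(2) y1(3)] show ?thesis
    proof (elim disjE conjE)
      assume "(x + 1, y1 + 1) \<in> E"
      from ext[OF this] show ?thesis using y1 X that by auto
    qed (use y1 in auto)
  qed
  \<comment> \<open>Avoiding the \<open>S\<close>-image of \<open>B\<close> as well makes
    \<open>e = - 1 / x\<close> generic.\<close>
  have "finite (B \<union> (\<lambda>c. - 1 / c) ` B)" using finite_B by simp
  then obtain x where x: "max (max X y1) 1 < x" "x \<notin> B \<union> (\<lambda>c. - 1 / c) ` B"
    by (rule generic_between[of _ "max (max X y1) 1" "max (max X y1) 1 + 1"]) auto
  define e where "e = - 1 / x"
  have xe: "- 1 / e = x" using x by (simp add: e_def)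
  have "e \<in> B \<Longrightarrow> x \<in> (\<lambda>c. - 1 / c) ` B" by (rule image_eqI[of _ _ e]) (use xe in simp_all)
  then have e: "e \<notin> B" using x by auto
  have p: "a \<le> - 1 / y1" "- 1 / y1 \<le> b" "(e, - 1 / y1) \<in> E"
    using pre[of x] x by (auto simp: e_def)
  \<comment> \<open>The condition \<open>- (a * b) \<le> 1\<close> places \<open>y1\<close> first
    above \<open>0\<close> and then above \<open>b\<close>; hence all heights up to \<open>b\<close>
    lie below \<open>y1\<close>.\<close>
  have y1pos: "0 < y1"
  proof (rule ccontr)
    assume "\<not> 0 < y1"
    moreover have "y1 \<noteq> 0" using y1(3) in_B by auto
    ultimately have neg: "y1 < 0" by simp
    then have "b * y1 \<le> - 1" using p(2) by (simp add: field_simps)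
    moreover have "b * (a + 1) < b * y1" using b y1 by simp
    ultimately show False using params b by (simp add: algebra_simps)
  qed
  have ay: "a * y1 \<le> - 1" using p(1) y1pos by (simp add: field_simps)
  have "b \<le> y1"
  proof (rule ccontr)
    assume "\<not> b \<le> y1"
    moreover have "a < 0" using ay params(1) by (cases "a = 0") auto
    ultimately have "a * b < a * y1" by simp
    then show False using ay params by simp
  qed
  then have by1: "b < y1" using y1(3) in_B by (metis order_le_less)
  have "- 1 / b < - 1 / y1" using by1 b y1pos by (simp add: field_simps)
  moreover have "- 1 / b < b - 1"
  proof -
    have "0 < (b - 1/2)\<^sup>2 + 3/4" by (simp add: add_nonneg_pos)
    then show ?thesis using b by (simp add: field_simps power2_eq_square)
  qed
  \<comment> \<open>The interval is chosen so that only \<open>T\<close> can cover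
    \<open>(e, y)\<close>: for negative \<open>y\<close> above \<open>- 1 / b\<close> the
    \<open>S\<close>-preimage has height above \<open>b\<close>, and for \<open>y < b - 1\<close>
    the height \<open>y + 1\<close> is below \<open>b\<close>.\<close>
  ultimately obtain y where y: "- 1 / b < y" "y < min (- 1 / y1) (b - 1)" "y \<notin> B"
    using generic_between[OF finite_B, of "- 1 / b" "min (- 1 / y1) (b - 1)"] by auto
  have "- 1 / y1 < e" using x y1pos by (simp add: e_def field_simps)
  then have "(e, y) \<in> E" using lower_mono[OF p(3), of e y] y by simp
  have y_neg: "y < 0" using y y1pos by (smt (verit) divide_neg_pos)
  from cover[OF \<open>(e, y) \<in> E\<close> e y(3)] show False
  proof (elim disjE conjE)
    assume up: "(e - 1, y - 1) \<in> E" "y - 1 \<le> a"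
    \<comment> \<open>Far below, \<open>x = e\<close> is covered both by \<open>T\<close> and by the \<open>S\<close>-image of \<open>x = + \<infinity>\<close>.\<close>
    define m where "m = min (min y a) (- 1 / b)"
    obtain z where z: "m - 1 < z" "z < m" "z \<notin> B"
      using generic_between[OF finite_B, of "m - 1" m] by auto
    then have z': "z < y" "z < a" "z < - 1 / b" by (auto simp: m_def)
    have "z < 0" using z' y_neg by simp
    have zb: "- 1 / z \<le> b" "0 < - 1 / z"
      using z'(3) b \<open>z < 0\<close> by (auto simp: field_simps)
    have "y - 1 < e - 1" using y \<open>- 1 / y1 < e\<close> by simp
    then have "(e - 1, z - 1) \<in> E" using lower_mono[OF up(1)] z' by simp
    moreover have "(- 1 / e, - 1 / z) \<in> E"
      unfolding xe using lower_mono[OF X(2,1), of x "- 1 / z"] x zb by1 y1 by simp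
    ultimately show False using disjoint_up[OF e z(3)] zb z' params by auto
  next
    assume "- 1 / y \<le> b"
    then show False using y y_neg b by (simp add: field_simps)
  qed (use y in auto)
qed

text \<open>Conjugation by the reflection exchanges \<open>T\<close> with its inverse and fixes
  \<open>S\<close>. So \<open>disjoint_up\<close> and \<open>disjoint_down\<close> change places, as
  do \<open>step_up\<close> and \<open>step_down\<close>, while \<open>cover\<close> and
  \<open>step_inv\<close> go over into themselves.\<close>

lemma tiling_reflect: "tiling (- b) (- a) (reflect E) (uminus ` B)"
proof
  have mem: "x \<in> uminus ` B \<longleftrightarrow> - x \<in> B" for x
    by (metis image_iff verit_minus_simplify(4))
  show "0 \<in> uminus ` B" "- a \<in> uminus ` B" "- b \<in> uminus ` B"
    using in_B by (auto simp: mem)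
  show "lower_staircase (reflect E)" "lower_staircase (reflect (reflect E))"
    using lower upper by auto
  fix x y :: real
  have eqs: "- (x - 1) = - x + 1" "- (y - 1) = - y + 1" "- (x + 1) = - x - 1" "- (y + 1) = - y - 1"
    "- (- 1 / x) = - 1 / (- x)" "- (- 1 / y) = - 1 / (- y)"
    by auto
  { assume "(x, y) \<in> reflect E" "x \<notin> uminus ` B" "y \<notin> uminus ` B"
    then show "y - 1 \<le> - b \<and> (x - 1, y - 1) \<in> reflect E \<or>
      - b \<le> - 1 / y \<and> - 1 / y \<le> - a \<and> (- 1 / x, - 1 / y) \<in> reflect E \<or>
      - a \<le> y + 1 \<and> (x + 1, y + 1) \<in> reflect E"
      using cover[of "- x" "- y"] unfolding mem mem_reflect eqs by auto }
  { assume "x \<notin> uminus ` B" "y \<notin> uminus ` B" "(x - 1, y - 1) \<in> reflect E" "y - 1 \<le> - b"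
      "(- 1 / x, - 1 / y) \<in> reflect E" "- b \<le> - 1 / y" "- 1 / y \<le> - a"
    then show False
      using disjoint_down[of "- x" "- y"] unfolding mem mem_reflect eqs by auto }
  { assume "x \<notin> uminus ` B" "y \<notin> uminus ` B" "(x + 1, y + 1) \<in> reflect E" "- a \<le> y + 1"
      "(- 1 / x, - 1 / y) \<in> reflect E" "- b \<le> - 1 / y" "- 1 / y \<le> - a"
    then show False
      using disjoint_up[of "- x" "- y"] unfolding mem mem_reflect eqs by auto }
  { assume "(x, y) \<in> reflect E" "x \<notin> uminus ` B" "y \<notin> uminus ` B" "y \<le> - b"
    then show "(x + 1, y + 1) \<in> reflect E"
      using step_down[of "- x" "- y"] unfolding mem mem_reflect eqs by auto }
  { assume "(x, y) \<in> reflect E" "x \<notin> uminus ` B" "y \<notin> uminus ` B" "- a \<le> y"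
    then show "(x - 1, y - 1) \<in> reflect E"
      using step_up[of "- x" "- y"] unfolding mem mem_reflect eqs by auto }
  { assume "(x, y) \<in> reflect E" "x \<notin> uminus ` B" "y \<notin> uminus ` B" "- b \<le> y" "y \<le> - a"
    then show "(- 1 / x, - 1 / y) \<in> reflect E"
      using step_inv[of "- x" "- y"] unfolding mem mem_reflect eqs by auto }
qed (use params finite_B in \<open>auto simp: algebra_simps\<close>)

lemma upper_height:
  assumes "(x, y) \<in> E" "x < y"
  shows "b - 1 \<le> y"
  using tiling.lower_height[OF tiling_reflect, of "- x" "- y"] assms by simp

end

section \<open>From attractors to tilings\<close>

lemma lower_staircase_quadrants:
  fixes U L :: "(real \<times> real) set"
  assumes "finite L" "\<And>p q. (p, q) \<in> U \<Longrightarrow> p \<le> q"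
  shows "lower_staircase {(x, y). x \<noteq> y \<and>
    ((\<exists>(p, q) \<in> U. x \<le> p \<and> q \<le> y) \<or> (\<exists>(p, q) \<in> L. p \<le> x \<and> y \<le> q))}"
    (is "lower_staircase ?E")
proof -
  \<comment> \<open>Corners in \<open>U\<close> satisfy \<open>p \<le> q\<close>, so their quadrants
    do not reach below the diagonal.\<close>
  have low: "(x, y) \<in> ?E \<longleftrightarrow> (\<exists>(p, q) \<in> L. p \<le> x \<and> y \<le> q)" if "y < x" for x y
    using assms(2) that by fastforce
  have mono: "(x', y') \<in> ?E" if "(x, y) \<in> ?E" "y < x" "x \<le> x'" "y' \<le> y" for x y x' y'
    using that low[of y x] low[of y' x'] by fastforce
  show ?thesis
    unfolding lower_staircase_def
  proof (intro conjI impI)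
    show "\<forall>x y x' y'. (x, y) \<in> ?E \<longrightarrow> y < x \<longrightarrow> x \<le> x' \<longrightarrow> y' \<le> y \<longrightarrow> (x', y') \<in> ?E"
      using mono by blast
    assume "\<exists>x y. (x, y) \<in> ?E \<and> y < x"
    then have ne: "L \<noteq> {}" using low by fastforce
    define r where "r = Max (snd ` L)"
    define s where "s = Min (fst ` L)"
    have "r \<in> snd ` L" "s \<in> fst ` L"
      using ne assms(1) by (auto simp: r_def s_def)
    then obtain p q where p: "(p, r) \<in> L" and q: "(s, q) \<in> L" by auto
    have bounds: "s \<le> p' \<and> q' \<le> r" if "(p', q') \<in> L" for p' q'
      using that assms(1) unfolding r_def s_def by (force intro: Max_ge Min_le)
    show "\<exists>r s X Y. (\<forall>x y. (x, y) \<in> ?E \<longrightarrow> y < x \<longrightarrow> s \<le> x \<and> y \<le> r) \<and>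
         r < X \<and> (X, r) \<in> ?E \<and> Y < s \<and> (s, Y) \<in> ?E"
    proof (intro exI conjI allI impI)
      fix x y assume "(x, y) \<in> ?E" "y < x"
      then obtain p' q' where "(p', q') \<in> L" "p' \<le> x" "y \<le> q'" using low by blast
      then show "s \<le> x" "y \<le> r" using bounds[of p' q'] by auto
    next
      \<comment> \<open>The corners \<open>(p, r)\<close> and \<open>(s, q)\<close> may lie on the
        diagonal; moving right, respectively down, inside their quadrants brings them strictly below
        it.\<close>
      show "r < max p (r + 1)" "min q (s - 1) < s" by auto
      show "(max p (r + 1), r) \<in> ?E" "(s, min q (s - 1)) \<in> ?E"
        using p q by force+
    qed
  qed
qed

lemma finite_rectangular_staircase:
  assumes "finite_rectangular D"
  defines "E \<equiv> {(x, y). (Some x, Some y) \<in> D}"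
  shows "lower_staircase E" "lower_staircase (reflect E)"
proof -
  obtain U L :: "(real \<times> real) set" where UL: "finite U" "finite L"
      "\<forall>(p, q) \<in> U. p \<le> q" "\<forall>(p, q) \<in> L. q \<le> p"
    and D: "D = ((\<Union>(p, q) \<in> U. arc_le p \<times> arc_ge q) \<union> (\<Union>(p, q) \<in> L. arc_ge p \<times> arc_le q)) - diag"
    using assms(1) unfolding finite_rectangular_def by blast
  have E: "E = {(x, y). x \<noteq> y \<and>
    ((\<exists>(p, q) \<in> U. x \<le> p \<and> q \<le> y) \<or> (\<exists>(p, q) \<in> L. p \<le> x \<and> y \<le> q))}"
    unfolding E_def D by (auto simp: arc_le_def arc_ge_def diag_def image_iff)
  then show "lower_staircase E"
    using lower_staircase_quadrants[of L U] UL by auto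
  \<comment> \<open>Reflection turns upper quadrants into lower ones and negates their corners, so
    \<open>U\<close> and \<open>L\<close> exchange roles.\<close>
  define neg where "neg = (\<lambda>(p, q). (- p, - q) :: real \<times> real)"
  have "(\<exists>(p, q) \<in> neg ` L. x \<le> p \<and> q \<le> y) \<longleftrightarrow> (\<exists>(p, q) \<in> L. p \<le> - x \<and> - y \<le> q)"
    "(\<exists>(p, q) \<in> neg ` U. p \<le> x \<and> y \<le> q) \<longleftrightarrow> (\<exists>(p, q) \<in> U. - x \<le> p \<and> q \<le> - y)" for x y
    by (simp_all add: neg_def case_prod_unfold le_minus_iff[of x] le_minus_iff[of y]
        minus_le_iff[of _ x] minus_le_iff[of _ y])
  then have "reflect E = {(x, y). x \<noteq> y \<and>
    ((\<exists>(p, q) \<in> neg ` L. x \<le> p \<and> q \<le> y) \<or> (\<exists>(p, q) \<in> neg ` U. p \<le> x \<and> y \<le> q))}"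
    unfolding E by (auto simp: reflect_def)
  moreover have "p \<le> q" if "(p, q) \<in> neg ` L" for p q
    using that UL(4) by (auto simp: neg_def)
  ultimately show "lower_staircase (reflect E)"
    using lower_staircase_quadrants[of "neg ` U" "neg ` L"] UL(1) by simp
qed

text \<open>Surjectivity of \<open>F_map\<close> on \<open>D\<close> gives \<open>cover\<close>,
  injectivity gives \<open>disjoint_up\<close> and \<open>disjoint_down\<close>, and invariance of
  \<open>D\<close> gives the three step clauses. The removed sets \<open>N\<close> and
  \<open>N'\<close> lie on finitely many lines and are absorbed into \<open>B\<close>.\<close>

lemma ab_attractor_tiling:
  assumes "(a, b) \<in> ab_params" "ab_attractor a b D"
  shows "\<exists>B. tiling a b {(x, y). (Some x, Some y) \<in> D} B"
proof -
  define E where "E = {(x, y). (Some x, Some y) \<in> D}"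
  have mem_E: "(x, y) \<in> E \<longleftrightarrow> (Some x, Some y) \<in> D" for x y by (simp add: E_def)
  from assms(2) obtain A N N' where A: "finite A"
    and N: "N \<subseteq> {(x, y). x \<in> A \<or> y \<in> A}" "N' \<subseteq> {(x, y). x \<in> A \<or> y \<in> A}"
    and bij: "bij_betw (F_map a b) (D - N) (D - N')"
    unfolding ab_attractor_def essentially_bijective_def by blast
  define C where "C = {c. Some c \<in> A} \<union> {0, a, b}"
  have "{c. Some c \<in> A} = Some -` A" by auto
  then have fin_C: "finite C" using A by (simp add: C_def finite_vimageI)
  \<comment> \<open>A point off \<open>B\<close> has both its translates and its
    \<open>S\<close>-image off \<open>C\<close>, so a generic point has generic images and
    preimages.\<close>
  define B where "B = (\<Union>c\<in>C. {c, c + 1, c - 1, - 1 / c})"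
  have generic: "x \<notin> C" "x + 1 \<notin> C" "x - 1 \<notin> C" "- 1 / x \<notin> C" if "x \<notin> B" for x
  proof -
    show "x \<notin> C" using that by (auto simp: B_def)
    show "x + 1 \<notin> C" "x - 1 \<notin> C"
      using that unfolding B_def by fastforce+
    show "- 1 / x \<notin> C"
    proof
      assume "- 1 / x \<in> C"
      then have "- 1 / (- 1 / x) \<in> B" unfolding B_def by blast
      then show False using that by simp
    qed
  qed
  have C: "x \<noteq> 0" "x \<noteq> a" "x \<noteq> b" "Some x \<notin> A" if "x \<notin> C" for x
    using that by (auto simp: C_def)
  have diffN: "(Some x, Some y) \<in> D - N \<longleftrightarrow> (x, y) \<in> E"
      "(Some x, Some y) \<in> D - N' \<longleftrightarrow> (x, y) \<in> E" if "x \<notin> C" "y \<notin> C" for x y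
    using N C[OF that(1)] C[OF that(2)] by (auto simp: mem_E)
  have F: "F_map a b (Some x, Some y) = (if y < a then (Some (x + 1), Some (y + 1))
     else if y < b then (Some (- 1 / x), Some (- 1 / y)) else (Some (x - 1), Some (y - 1)))"
    if "x \<noteq> 0" "y \<noteq> 0" for x y
    using that by (simp add: F_map_def T_pow_def)
  have inj: "(x, y) = (x', y')"
    if "(x, y) \<in> E" "(x', y') \<in> E" "x \<notin> C" "y \<notin> C" "x' \<notin> C" "y' \<notin> C"
      "F_map a b (Some x, Some y) = F_map a b (Some x', Some y')" for x y x' y'
  proof -
    have "inj_on (F_map a b) (D - N)" using bij by (simp add: bij_betw_def)
    from inj_onD[OF this that(7)] show ?thesis using diffN(1) that by auto
  qed
  have fwd: "F_map a b (Some x, Some y) \<in> D" if "(x, y) \<in> E" "x \<notin> C" "y \<notin> C" for x y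
    using bij_betwE[OF bij] diffN(1)[of x y] that by blast
  have "tiling a b E B"
  proof
    show "a \<le> 0" "0 \<le> b" "1 \<le> b - a" "- (a * b) \<le> 1"
      using assms(1) by (auto simp: ab_params_def)
    show "finite B" using fin_C by (simp add: B_def)
    show "0 \<in> B" "a \<in> B" "b \<in> B" by (auto simp: B_def C_def)
    show "lower_staircase E" "lower_staircase (reflect E)"
      using finite_rectangular_staircase[of D] assms(2) by (auto simp: ab_attractor_def E_def)
  next
    fix x y :: real
    assume xy: "(x, y) \<in> E" "x \<notin> B" "y \<notin> B"
    note g = generic[OF xy(2)] generic[OF xy(3)]
    have x0: "x \<noteq> 0" "y \<noteq> 0" using C g by auto
    have "(Some x, Some y) \<in> F_map a b ` (D - N)"
      using bij diffN(2)[of x y] xy(1) g by (auto simp: bij_betw_def)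
    then obtain X Y where XY: "(X, Y) \<in> D" "F_map a b (X, Y) = (Some x, Some y)" by force
    \<comment> \<open>At \<open>y = \<infinity>\<close> the map translates and keeps the height
      infinite, so a preimage of a real point has real height.\<close>
    obtain y' where Y: "Y = Some y'"
      using XY(2) by (cases Y) (auto simp: F_map_def T_pow_def)
    consider "y' < a" | "a \<le> y'" "y' < b" | "a \<le> y'" "b \<le> y'" by linarith
    then show "y - 1 \<le> a \<and> (x - 1, y - 1) \<in> E \<or>
      a \<le> - 1 / y \<and> - 1 / y \<le> b \<and> (- 1 / x, - 1 / y) \<in> E \<or>
      b \<le> y + 1 \<and> (x + 1, y + 1) \<in> E"
    proof cases
      case 1
      then have "X = Some (x - 1)" "y' = y - 1"
        using XY(2) Y by (auto simp: F_map_def T_pow_def)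
      then show ?thesis using 1 XY(1) Y by (auto simp: mem_E)
    next
      case 2
      then have S: "S_map X = Some x" "S_map (Some y') = Some y"
        using XY(2) Y by (auto simp: F_map_def)
      have "X = Some (- 1 / x)" using S(1) x0 by (cases X) (auto split: if_splits)
      moreover have "y' = - 1 / y" using S(2) by (auto split: if_splits)
      ultimately show ?thesis using 2 XY(1) Y by (auto simp: mem_E)
    next
      case 3
      then have "X = Some (x + 1)" "y' = y + 1"
        using XY(2) Y assms(1) by (auto simp: F_map_def T_pow_def ab_params_def)
      then show ?thesis using 3 XY(1) Y by (auto simp: mem_E)
    qed
  next
    fix x y :: real
    assume x: "x \<notin> B" and y: "y \<notin> B" and p: "(x - 1, y - 1) \<in> E" "y - 1 \<le> a"
      "(- 1 / x, - 1 / y) \<in> E" "a \<le> - 1 / y" "- 1 / y \<le> b"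
    note g = generic[OF x] generic[OF y]
    have "y - 1 < a" "- 1 / y < b" using p C g by (auto simp: order_le_less)
    then have "F_map a b (Some (x - 1), Some (y - 1)) = F_map a b (Some (- 1 / x), Some (- 1 / y))"
      using C[of x] C[of "x - 1"] C[of y] C[of "y - 1"] g p by (simp add: F)
    \<comment> \<open>Two preimages of one point must coincide, which would make \<open>x\<close> a
      real root of \<open>x^2 - x + 1\<close>, a polynomial without real roots.\<close>
    from inj[OF p(1,3) _ _ _ _ this] g have "x - 1 = - 1 / x" by simp
    then have "(x - 1/2)\<^sup>2 + 3/4 = 0"
      using C[of x] g by (simp add: field_simps power2_eq_square)
    moreover have "0 \<le> (x - 1/2)\<^sup>2" by simp
    ultimately show False by linarith
  next
    fix x y :: real
    assume x: "x \<notin> B" and y: "y \<notin> B" and p: "(x + 1, y + 1) \<in> E" "b \<le> y + 1"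
      "(- 1 / x, - 1 / y) \<in> E" "a \<le> - 1 / y" "- 1 / y \<le> b"
    note g = generic[OF x] generic[OF y]
    have "a \<le> b" using assms(1) by (auto simp: ab_params_def)
    moreover have "- 1 / y < b" using p C g by (auto simp: order_le_less)
    ultimately have "F_map a b (Some (x + 1), Some (y + 1)) = F_map a b (Some (- 1 / x), Some (- 1 / y))"
      using C[of x] C[of "x + 1"] C[of y] C[of "y + 1"] g p by (simp add: F)
    from inj[OF p(1,3) _ _ _ _ this] g have "x + 1 = - 1 / x" by simp
    then have "(x + 1/2)\<^sup>2 + 3/4 = 0"
      using C[of x] g by (simp add: field_simps power2_eq_square)
    moreover have "0 \<le> (x + 1/2)\<^sup>2" by simp
    ultimately show False by linarith
  next
    fix x y :: real
    assume xy: "(x, y) \<in> E" "x \<notin> B" "y \<notin> B"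
    note g = C[OF generic(1)[OF xy(2)]] C[OF generic(1)[OF xy(3)]]
    note f = fwd[OF xy(1) generic(1)[OF xy(2)] generic(1)[OF xy(3)]]
    have ab: "a \<le> b" using assms(1) by (auto simp: ab_params_def)
    { assume "y \<le> a"
      then show "(x + 1, y + 1) \<in> E" using f g by (simp add: F mem_E) }
    { assume "b \<le> y"
      then show "(x - 1, y - 1) \<in> E" using f g ab by (simp add: F mem_E) }
    { assume "a \<le> y" "y \<le> b"
      then show "(- 1 / x, - 1 / y) \<in> E" using f g by (simp add: F mem_E) }
  qed
  then show ?thesis unfolding E_def by blast
qed

section \<open>Duality, reduced geodesics and the first dual digit\<close>

definition dual_set :: "(real \<times> real) set \<Rightarrow> (real \<times> real) set" where
  "dual_set E = {(x, y). (- y, - x) \<in> E}"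

lemma mem_dual_set [simp]: "(x, y) \<in> dual_set E \<longleftrightarrow> (- y, - x) \<in> E"
  by (simp add: dual_set_def)

lemma dual_set_reflect: "dual_set (reflect E) = reflect (dual_set E)"
  by (auto simp: dual_set_def reflect_def)

text \<open>This expresses that a whole box around \<open>(u, w)\<close> is reduced, with
  \<open>S\<close> undone. Coordinates equal to \<open>0\<close> are left out because
  \<open>S\<close> sends them to infinity.\<close>

definition reduced_near ::
    "real \<Rightarrow> real \<Rightarrow> (real \<times> real) set \<Rightarrow> real \<Rightarrow> real \<Rightarrow> real \<Rightarrow> bool" where
  "reduced_near a b E \<epsilon> u w \<longleftrightarrow>
     (\<forall>x y. \<bar>x - u\<bar> < \<epsilon> \<longrightarrow> \<bar>y - w\<bar> < \<epsilon> \<longrightarrow> x \<noteq> 0 \<longrightarrow> y \<noteq> 0 \<longrightarrow>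
        (- 1 / x, - 1 / y) \<in> E \<and> a \<le> - 1 / y \<and> - 1 / y \<le> b)"

lemma reduced_near_reflect:
  assumes "reduced_near a b E \<epsilon> u w"
  shows "reduced_near (- b) (- a) (reflect E) \<epsilon> (- u) (- w)"
  unfolding reduced_near_def
proof (intro allI impI)
  fix x y :: real
  assume "\<bar>x - - u\<bar> < \<epsilon>" "\<bar>y - - w\<bar> < \<epsilon>" "x \<noteq> 0" "y \<noteq> 0"
  then show "(- 1 / x, - 1 / y) \<in> reflect E \<and> - b \<le> - 1 / y \<and> - 1 / y \<le> - a"
    using assms[unfolded reduced_near_def, rule_format, of "- x" "- y"] by auto
qed

text \<open>The box serves twice: it leaves room for generic coordinates, and a small shift of
  \<open>u\<close> to the offending side turns the negation of a strict bound into a strict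
  violation.\<close>

lemma reduced_upper:
  assumes E: "tiling a b E B" and dual: "tiling a' b' (dual_set E) B'"
    and box: "reduced_near a b E \<epsilon> u w" and \<epsilon>: "0 < \<epsilon>" and w: "0 < w"
  shows "b < w" "- b' < u" "u < 1 - b'"
proof -
  interpret tiling a b E B by fact
  interpret dual: tiling a' b' "dual_set E" B' by fact
  \<comment> \<open>From \<open>a \<le> - 1 / y\<close> and \<open>- (a * b) \<le> 1\<close> one
    gets \<open>a * y \<le> a * b\<close> with \<open>a < 0\<close>. Applied a little to the left of
    \<open>w\<close>, this makes \<open>b < w\<close> strict.\<close>
  have b_le: "b \<le> y" if y: "\<bar>y - w\<bar> < \<epsilon>" "0 < y" for y
  proof -
    obtain x where "u < x" "x < u + \<epsilon>" "x \<notin> {0}"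
      using generic_between[of "{0}" u "u + \<epsilon>"] \<epsilon> by auto
    then have "a \<le> - 1 / y" using box[unfolded reduced_near_def, rule_format, of x y] y by auto
    then have ay: "a * y \<le> - 1" using y by (simp add: field_simps)
    then have "a < 0" using params(1) by (cases "a = 0") auto
    moreover have "a * y \<le> a * b" using ay params by simp
    ultimately show ?thesis by simp
  qed
  have "min \<epsilon> w > 0" using \<epsilon> w by simp
  then have "b \<le> w - min \<epsilon> w / 2" by (intro b_le) (auto simp: min_def)
  then show bw: "b < w" using \<open>min \<epsilon> w > 0\<close> by linarith
  define C where "C = B \<union> B' \<union> uminus ` B' \<union> (\<lambda>c. - 1 / c) ` B"
  have C: "finite C" using finite_B dual.finite_B by (simp add: C_def)
  obtain y where y: "w < y" "y < w + \<epsilon>" "y \<notin> C"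
    using generic_between[OF C, of w "w + \<epsilon>"] \<epsilon> by auto
  have generic: "z \<noteq> 0" "z \<notin> B" "- 1 / z \<notin> B" "- z \<notin> B'" if "z \<notin> C" for z
  proof -
    show "z \<noteq> 0" "z \<notin> B" using that in_B by (auto simp: C_def)
    have "- z \<in> B' \<Longrightarrow> z \<in> uminus ` B'" by (rule image_eqI[of _ _ "- z"]) auto
    then show "- z \<notin> B'" using that by (auto simp: C_def)
    have "- 1 / z \<in> B \<Longrightarrow> z \<in> (\<lambda>c. - 1 / c) ` B"
      by (rule image_eqI[of _ _ "- 1 / z"]) (use \<open>z \<noteq> 0\<close> in auto)
    then show "- 1 / z \<notin> B" using that by (auto simp: C_def)
  qed
  have near: "(x, y) \<in> E" "(- 1 / x, - 1 / y) \<in> E" "a \<le> - 1 / y" "- 1 / y \<le> b"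
    if "\<bar>x - u\<bar> < \<epsilon>" "x \<notin> C" for x
  proof -
    show p: "(- 1 / x, - 1 / y) \<in> E" "a \<le> - 1 / y" "- 1 / y \<le> b"
      using box[unfolded reduced_near_def, rule_format, of x y] that y generic by auto
    \<comment> \<open>The point \<open>S (x, y)\<close> lies in the strip on which the map acts as
      \<open>S\<close>, and \<open>S\<close> is an involution.\<close>
    show "(x, y) \<in> E"
      using step_inv[OF p(1) _ _ p(2,3)] generic that(2) y(3) by simp
  qed
  show "- b' < u"
  proof (rule ccontr)
    assume le: "\<not> - b' < u"
    obtain x where x: "u - \<epsilon> < x" "x < u" "x \<notin> C"
      using generic_between[OF C, of "u - \<epsilon>" u] \<epsilon> by auto
    have "x < - b'" using x le by simp
    note x = x this
    have n: "\<bar>x - u\<bar> < \<epsilon>" using x by simp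
    \<comment> \<open>In dual coordinates the height is \<open>- x > b'\<close>, so the dual map
      translates by \<open>- 1\<close>; back in \<open>E\<close> this is a translation by
      \<open>+ 1\<close>, giving \<open>(x, y)\<close> a second preimage.\<close>
    have "(- y, - x) \<in> dual_set E" using near(1)[OF n x(3)] by simp
    from dual.step_down[OF this] have "(x + 1, y + 1) \<in> E"
      using generic x y by (auto simp: algebra_simps)
    then show False
      using disjoint_down[of x y] near[OF n x(3)] generic x y bw by auto
  qed
  show "u < 1 - b'"
  proof (rule ccontr)
    assume le: "\<not> u < 1 - b'"
    obtain x where x: "u < x" "x < u + \<epsilon>" "x \<notin> C"
      using generic_between[OF C, of u "u + \<epsilon>"] \<epsilon> by auto
    have "1 - b' < x" using x le by simp
    note x = x this
    then have E: "(x, y) \<in> E" using near[of x] by simp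
    show False
    proof (cases x y rule: linorder_cases)
      case less
      then show False using dual.upper_height[of "- y" "- x"] E x by simp
    next
      case equal
      \<comment> \<open>On the diagonal neither height bound applies, so the abscissa is moved
        slightly to the right, below the diagonal.\<close>
      obtain x' where "x < x'" "x' < u + \<epsilon>" "x' \<notin> C"
        using generic_between[OF C, of x "u + \<epsilon>"] x by auto
      then show False using lower_height[of x' y] near[of x'] x y bw params equal by simp
    next
      case greater
      then show False using lower_height[OF E] y bw params by simp
    qed
  qed
qed

text \<open>The reflected tilings and box reduce this to the upper case, with \<open>- a'\<close> in
  the role of \<open>b'\<close>.\<close>

lemma reduced_lower:
  assumes E: "tiling a b E B" and dual: "tiling a' b' (dual_set E) B'"
    and box: "reduced_near a b E \<epsilon> u w" and \<epsilon>: "0 < \<epsilon>" and w: "w < 0"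
  shows "w < a" "- 1 - a' < u" "u < - a'"
proof -
  note R = reduced_upper[OF tiling.tiling_reflect[OF E]
    tiling.tiling_reflect[OF dual, folded dual_set_reflect] reduced_near_reflect[OF box] \<epsilon>]
  show "w < a" "- 1 - a' < u" "u < - a'" using R w by auto
qed

text \<open>The bounds on \<open>u\<close> confine it to an open interval of length one, which gives
  the floor in the dual digit of \<open>n - u\<close> the required value. The sign of
  \<open>n\<close>, forced by \<open>b < w\<close> or \<open>w < a\<close>, puts
  \<open>n - u\<close> above \<open>b'\<close> or below \<open>a'\<close>, hence in the matching
  branch of \<open>ab_int\<close>.\<close>

lemma reduced_digit:
  assumes E: "tiling a b E B" and dual: "tiling a' b' (dual_set E) B'"
    and box: "reduced_near a b E \<epsilon> u w" and \<epsilon>: "0 < \<epsilon>" and w: "w \<noteq> 0"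
  shows "ab_int a' b' (of_int (ab_int a b w) - u) = ab_int a b w"
proof -
  interpret tiling a b E B by fact
  interpret dual: tiling a' b' "dual_set E" B' by fact
  show ?thesis
  proof (cases "0 < w")
    case True
    note R = reduced_upper[OF E dual box \<epsilon> True]
    define n where "n = ab_int a b w"
    have "n = \<lfloor>w - b\<rfloor> + 1" using R params by (simp add: ab_int_def n_def)
    then have n: "1 \<le> n" using R(1) by simp
    have "b' < of_int n - u" using R n by linarith
    moreover have "\<lfloor>of_int n - u - b'\<rfloor> = n - 1" using R by (intro floor_unique) auto
    ultimately show ?thesis using dual.params unfolding n_def[symmetric] by (simp add: ab_int_def)
  next
    case False
    then have "w < 0" using w by simp
    note R = reduced_lower[OF E dual box \<epsilon> this]
    define n where "n = ab_int a b w"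
    have "n = \<lfloor>w - a\<rfloor>" using R by (simp add: ab_int_def n_def)
    then have n: "n \<le> - 1" using R(1) by linarith
    have "of_int n - u < a'" using R n by linarith
    moreover have "\<lfloor>of_int n - u - a'\<rfloor> = n" using R by (intro floor_unique) auto
    ultimately show ?thesis unfolding n_def[symmetric] by (simp add: ab_int_def)
  qed
qed

section \<open>Two-sided orbits and their coding sequences\<close>

lemma coded_orbit_step:
  assumes "coded_orbit a b D u w"
  defines "n \<equiv> coding_sequence a b w"
  shows "u k \<noteq> 0" "w k \<noteq> 0" "u k \<noteq> of_int (n k)" "w k \<noteq> of_int (n k)"
    "u (k + 1) = - 1 / (u k - of_int (n k))" "w (k + 1) = - 1 / (w k - of_int (n k))"
proof -
  \<comment> \<open>The end points of the next geodesic are real, which excludes the pole of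
    \<open>S_map\<close>.\<close>
  have R: "u j \<noteq> of_int (n j) \<and> w j \<noteq> of_int (n j) \<and>
      u (j + 1) = - 1 / (u j - of_int (n j)) \<and> w (j + 1) = - 1 / (w j - of_int (n j))" for j
  proof -
    have "(Some (u (j + 1)), Some (w (j + 1))) = R_map a b (u j, w j)"
      using assms(1) by (simp add: coded_orbit_def)
    then show ?thesis
      by (auto simp: R_map_def Let_def T_pow_def n_def coding_sequence_def split: if_splits)
  qed
  show "u k \<noteq> of_int (n k)" "w k \<noteq> of_int (n k)"
    "u (k + 1) = - 1 / (u k - of_int (n k))" "w (k + 1) = - 1 / (w k - of_int (n k))"
    using R[of k] by auto
  \<comment> \<open>Each geodesic of a two-sided orbit has a predecessor, so its end points have the
    form \<open>- 1 / t\<close> with \<open>t\<close> nonzero.\<close>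
  show "u k \<noteq> 0" "w k \<noteq> 0" using R[of "k - 1"] by auto
qed

lemma Lam_real:
  assumes "(Some x, Some y) \<in> Lam a b D" "x \<noteq> 0" "y \<noteq> 0"
  shows "(Some (- 1 / x), Some (- 1 / y)) \<in> D" "a \<le> - 1 / y" "- 1 / y \<le> b"
proof -
  obtain X Y where XY: "(X, Y) \<in> D" "Y \<in> Some ` {a..b}" "S_map X = Some x" "S_map Y = Some y"
    using assms(1) by (auto simp: Lam_def)
  have "X = Some (- 1 / x)" using XY(3) assms by (cases X) (auto split: if_splits)
  moreover have "Y = Some (- 1 / y)" using XY(4) assms by (cases Y) (auto split: if_splits)
  ultimately show "(Some (- 1 / x), Some (- 1 / y)) \<in> D" "a \<le> - 1 / y" "- 1 / y \<le> b"
    using XY by auto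
qed

lemma interior_Lam_reduced_near:
  assumes "(u, w) \<in> interior {(x, y). (Some x, Some y) \<in> Lam a b D}"
  shows "\<exists>\<epsilon>>0. reduced_near a b {(x, y). (Some x, Some y) \<in> D} \<epsilon> u w"
proof -
  let ?V = "{(x, y). (Some x, Some y) \<in> Lam a b D}"
  obtain G H where GH: "open G" "open H" "u \<in> G" "w \<in> H" "G \<times> H \<subseteq> ?V"
    using open_prod_elim[OF open_interior assms] interior_subset[of ?V]
    by (smt (verit) mem_Sigma_iff subset_trans)
  obtain e1 e2 where e: "e1 > 0" "\<And>x. dist x u < e1 \<Longrightarrow> x \<in> G"
      "e2 > 0" "\<And>x. dist x w < e2 \<Longrightarrow> x \<in> H"
    using GH by (metis open_dist)
  have "reduced_near a b {(x, y). (Some x, Some y) \<in> D} (min e1 e2) u w"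
    unfolding reduced_near_def
  proof (intro allI impI)
    fix x y assume xy: "\<bar>x - u\<bar> < min e1 e2" "\<bar>y - w\<bar> < min e1 e2" "x \<noteq> 0" "y \<noteq> 0"
    then have "(Some x, Some y) \<in> Lam a b D"
      using e GH(5) by (auto simp: dist_real_def)
    from Lam_real[OF this xy(3,4)]
    show "(- 1 / x, - 1 / y) \<in> {(x, y). (Some x, Some y) \<in> D} \<and> a \<le> - 1 / y \<and> - 1 / y \<le> b"
      by simp
  qed
  then show ?thesis using e by (intro exI[of _ "min e1 e2"]) auto
qed

text \<open>Since \<open>psi\<close> is an involution, membership in its image is tested by applying
  it once more.\<close>

lemma dual_set_psi:
  "{(x, y). (Some x, Some y) \<in> psi ` D} = dual_set {(x, y). (Some x, Some y) \<in> D}"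
proof -
  have "(Some x, Some y) \<in> psi ` D \<longleftrightarrow> (Some (- y), Some (- x)) \<in> D" for x y
  proof
    assume "(Some x, Some y) \<in> psi ` D"
    then show "(Some (- y), Some (- x)) \<in> D"
      by (auto simp: psi_def eq_commute[of "Some x"] eq_commute[of "Some y"])
  next
    assume "(Some (- y), Some (- x)) \<in> D"
    then show "(Some x, Some y) \<in> psi ` D" by (rule rev_image_eqI) (simp add: psi_def)
  qed
  then show ?thesis by auto
qed

theorem theorem5p6:
  fixes a b a' b' :: real
    and D :: "(xreal \<times> xreal) set"
    and u w :: "int \<Rightarrow> real"
    and n :: "int \<Rightarrow> int"
  assumes "(a, b) \<in> ab_params"
    and "ab_attractor a b D"
    and "dual_expansion D a' b'"
    and "coded_orbit a b D u w"
    and "n = coding_sequence a b w"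
  shows "ab_expansion a b (w 0) = (\<lambda>k. n (int k)) \<and>
         ab_expansion a' b' (1 / u 0) = (\<lambda>k. n (- 1 - int k)) \<and>
         (Some (u 1), Some (w 1)) =
           (S_map (T_pow (- n 0) (Some (u 0))), S_map (T_pow (- n 0) (Some (w 0)))) \<and>
         ab_expansion a b (w 1) = (\<lambda>k. n (1 + int k)) \<and>
         ab_expansion a' b' (1 / u 1) = (\<lambda>k. n (- int k))"
proof -
  note step = coded_orbit_step[OF assms(4), folded assms(5)]
  have digit: "n k = ab_int a b (w k)" for k using assms(5) by (simp add: coding_sequence_def)
  let ?E = "{(x, y). (Some x, Some y) \<in> D}"
  obtain B where B: "tiling a b ?E B"
    using ab_attractor_tiling[OF assms(1,2)] by blast
  obtain B' where B': "tiling a' b' (dual_set ?E) B'"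
    using ab_attractor_tiling[of a' b' "psi ` D"] assms(3)
    unfolding dual_expansion_def dual_set_psi by blast
  \<comment> \<open>The range \<open>k \<le> 0\<close> is where the orbit is known to run through
    the interior. The number \<open>1 / u (k + 1)\<close> equals \<open>n k - u k\<close>, so its
    first dual digit is the digit of \<open>w k\<close>.\<close>
  have dual_digit: "ab_int a' b' (1 / u (k + 1)) = n k" if "k \<le> 0" for k
  proof -
    have "(u k, w k) \<in> interior {(x, y). (Some x, Some y) \<in> Lam a b D}"
      using assms(4) that by (simp add: coded_orbit_def)
    from interior_Lam_reduced_near[OF this] obtain \<epsilon>
      where "\<epsilon> > 0" "reduced_near a b ?E \<epsilon> (u k) (w k)" by blast
    from reduced_digit[OF B B' this(2,1) step(2)]
    have "ab_int a' b' (of_int (n k) - u k) = n k" by (simp add: digit)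
    moreover have "1 / u (k + 1) = of_int (n k) - u k" using step(5)[of k] by simp
    ultimately show ?thesis by simp
  qed
  have tail: "ab_tail a b (w j) k = w (j + int k)" for j k
  proof (induction k)
    case (Suc k)
    have "j + int (Suc k) = j + int k + 1" by simp
    then show ?case using step(6)[of "j + int k"] Suc by (simp only: ab_tail.simps digit)
  qed simp
  \<comment> \<open>Removing the dual digit \<open>n m\<close> from \<open>1 / u (m + 1)\<close>
    leaves \<open>- u m\<close>, so the next tail is \<open>1 / u m\<close>: the dual expansion
    follows the orbit backwards. Starting at \<open>j \<le> 1\<close> keeps every index
    \<open>m\<close> at most \<open>0\<close>.\<close>
  have dual_tail: "ab_tail a' b' (1 / u j) k = 1 / u (j - int k)" if "j \<le> 1" for j k
  proof (induction k)
    case (Suc k)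
    define m where "m = j - int k - 1"
    have m: "j - int k = m + 1" "j - int (Suc k) = m" "m \<le> 0" using that by (auto simp: m_def)
    have "1 / u (m + 1) - of_int (n m) = - u m" using step(5)[of m] by simp
    then show ?case using Suc dual_digit[OF m(3)] unfolding m by simp
  qed simp
  have expansion: "ab_expansion a b (w j) = (\<lambda>k. n (j + int k))" for j
    by (simp add: fun_eq_iff ab_expansion_def tail digit)
  have dual_expansion: "ab_expansion a' b' (1 / u j) = (\<lambda>k. n (j - 1 - int k))" if "j \<le> 1" for j
  proof
    fix k
    show "ab_expansion a' b' (1 / u j) k = n (j - 1 - int k)"
      using dual_digit[of "j - 1 - int k"] that
      by (simp add: ab_expansion_def dual_tail algebra_simps)
  qed
  have "(Some (u 1), Some (w 1)) =
      (S_map (T_pow (- n 0) (Some (u 0))), S_map (T_pow (- n 0) (Some (w 0))))"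
    using step(3-6)[of 0] by (simp add: T_pow_def)
  then show ?thesis
    using expansion[of 0] expansion[of 1] dual_expansion[of 0] dual_expansion[of 1] by simp
qed

end
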